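(* Let $a$ be a non-negative integer, and let $\delta_1,\delta_2,\tau\in\{\pm 1\}$. Then for any integer $m$ satisfying $0\leq m\leq a$, we have \begin{align*} &\sum_{i=0}^a\binom{i}{m}M_{\mathcal{A}}(\{1\}^{a+2};\delta_1,\delta_1\tau,\ldots,\delta_1\tau^{a-i},\delta_1\delta_2\tau^{a-i},\ldots,\delta_1\delta_2\tau^{a-1},\delta_1\delta_2\tau^{a})\\ &+\sum_{i=0}^a\binom{i}{a-m}M_{\mathcal{A}}(\{1\}^{a+2};\delta_2,\delta_2\tau,\ldots,\delta_2\tau^{a-i},\delta_1\delta_2\tau^{a-i},\ldots,\delta_1\delta_2\tau^{a-1},\delta_1\delta_2\tau^{a})\\ &=(-1)^{m+1}M_{\mathcal{A}}(\{1\}^{a+2};\delta_1,\delta_1\tau,\ldots,\delta_1\tau^{a-m},-\delta_2\tau^{m},-\delta_2\tau^{m-1},\ldots,-\delta_2\tau,-\delta_2). \end{align*} In the first two sums the sign sequence consists of a block of length $a-i+1$ (namely $\delta_1\tau^{s}$, respectively $\delta_2\tau^{s}$, for $s=0,\ldots,a-i$) followed by a block of length $i+1$ (namely $\delta_1\delta_2\tau^{s}$ for $s=a-i,\ldots,a$); on the right-hand side it consists of $\delta_1\tau^s$ for $s=0,\ldots,a-m$ followed by $-\delta_2\tau^{s}$ for $s=m,m-1,\ldots,0$.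
   Context: Let $\mathcal{P}$ be the set of primes and $\mathcal{A}:=\prod_{p\in\mathcal{P}}(\mathbb{Z}/p\mathbb{Z})\big/\bigoplus_{p\in\mathcal{P}}(\mathbb{Z}/p\mathbb{Z})$, in which an element is determined by its components at all but finitely many primes. For positive integers $k_1,\ldots,k_r$, signs $\varepsilon_1,\ldots,\varepsilon_r\in\{\pm1\}$ and a positive integer $N$, put $$M_N(k_1,\ldots,k_r;\varepsilon_1,\ldots,\varepsilon_r):=\sum_{0<m_1<\cdots<m_r<N}\frac{(1+\varepsilon_1(-1)^{m_1})\cdots(1+\varepsilon_r(-1)^{m_r})}{m_1^{k_1}\cdots m_r^{k_r}},$$ and define the finite multiple mixed value $M_{\mathcal{A}}(k_1,\ldots,k_r;\varepsilon_1,\ldots,\varepsilon_r):=\bigl(M_p(k_1,\ldots,k_r;\varepsilon_1,\ldots,\varepsilon_r)\bmod p\bigr)_{p\in\mathcal{P}}\in\mathcal{A}$. The symbol $\{c\}^n$ denotes the string $c,\ldots,c$ with $n$ repetitions. Binomial coefficients $\binom{i}{m}$ are $0$ if $m>i$. *)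

theory Defs
  imports "HOL-Number_Theory.Number_Theory"
begin

text \<open>
  The ring \<open>\<A>\<close> is the product of the \<open>\<int>/p\<int>\<close> over all primes modulo their direct sum. A component in
  \<open>\<int>/p\<int>\<close> is represented by an integer, so a family \<open>f\<close> stands for \<open>(f p mod p)\<^sub>p\<close>; two families
  define the same element iff their components agree in \<open>\<int>/p\<int>\<close> for all but finitely many primes.
  The values of \<open>f\<close> at non-primes are irrelevant.
\<close>

definition calA_rel :: "(nat \<Rightarrow> int) \<Rightarrow> (nat \<Rightarrow> int) \<Rightarrow> bool" where
  "calA_rel f g \<longleftrightarrow> finite {p. prime p \<and> \<not> [f p = g p] (mod int p)}"

lemma calA_rel_combine:
  assumes "calA_rel f g" "calA_rel f' g'"
    and "\<And>p. [f p = g p] (mod int p) \<Longrightarrow> [f' p = g' p] (mod int p) \<Longrightarrow> [h p = k p] (mod int p)"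
  shows "calA_rel h k"
proof -
  have "{p. prime p \<and> \<not> [h p = k p] (mod int p)} \<subseteq>
    {p. prime p \<and> \<not> [f p = g p] (mod int p)} \<union> {p. prime p \<and> \<not> [f' p = g' p] (mod int p)}"
    using assms(3) by blast
  thus ?thesis
    using assms(1,2) unfolding calA_rel_def by (meson finite_UnI finite_subset)
qed

lemma equivp_calA_rel: "equivp calA_rel"
proof (rule equivpI)
  show "reflp calA_rel"
    by (rule reflpI) (simp add: calA_rel_def)
  show "symp calA_rel"
    by (rule sympI) (simp add: calA_rel_def cong_sym_eq)
  show "transp calA_rel"
    by (rule transpI, erule (1) calA_rel_combine) (rule cong_trans)
qed

quotient_type calA = "nat \<Rightarrow> int" / calA_rel
  morphisms calA_rep calA_of
  by (rule equivp_calA_rel)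

instantiation calA :: comm_ring_1
begin

lift_definition zero_calA :: calA is "\<lambda>_. 0" .

lift_definition one_calA :: calA is "\<lambda>_. 1" .

lift_definition plus_calA :: "calA \<Rightarrow> calA \<Rightarrow> calA" is "\<lambda>f g p. f p + g p"
  by (erule (1) calA_rel_combine) (rule cong_add)

lift_definition minus_calA :: "calA \<Rightarrow> calA \<Rightarrow> calA" is "\<lambda>f g p. f p - g p"
  by (erule (1) calA_rel_combine) (rule cong_diff)

lift_definition times_calA :: "calA \<Rightarrow> calA \<Rightarrow> calA" is "\<lambda>f g p. f p * g p"
  by (erule (1) calA_rel_combine) (rule cong_mult)

lift_definition uminus_calA :: "calA \<Rightarrow> calA" is "\<lambda>f p. - f p"
  by (rule calA_rel_combine) (assumption, assumption, simp add: cong_minus_minus_iff)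

instance
proof
  have "{p :: nat. prime p \<and> \<not> [0 = 1] (mod int p)} = {p. prime p}"
    by (auto simp: cong_def dest: prime_gt_1_int)
  thus "(0 :: calA) \<noteq> 1"
    by transfer (simp add: calA_rel_def primes_infinite)
qed (transfer; simp add: calA_rel_def algebra_simps)+

end

text \<open>
  Reduction of a rational number modulo \<open>p\<close>. This is meaningful only if \<open>p\<close> does not divide the
  denominator in lowest terms, which is always the case below, where \<open>0 < m\<^sub>j < p\<close>.
\<close>

definition rat_mod :: "nat \<Rightarrow> rat \<Rightarrow> int" where
  "rat_mod p x = (case quotient_of x of (c, d) \<Rightarrow> c * modular_inverse (int p) d mod int p)"

definition mmv_sum :: "nat \<Rightarrow> nat list \<Rightarrow> int list \<Rightarrow> rat" where
  "mmv_sum N ks es =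
     (\<Sum>ms | length ms = length ks \<and> sorted_wrt (<) ms \<and> set ms \<subseteq> {0<..<N}.
        (\<Prod>j<length ks. of_int (1 + es ! j * (-1) ^ (ms ! j))) /
        (\<Prod>j<length ks. of_nat (ms ! j) ^ (ks ! j)))"

definition finite_mmv :: "nat list \<Rightarrow> int list \<Rightarrow> calA" where
  "finite_mmv ks es = calA_of (\<lambda>p. rat_mod p (mmv_sum p ks es))"

end

theory Submission
  imports Defs "HOL-Computational_Algebra.Formal_Power_Series"
begin

text \<open>
  For weights all equal to \<open>1\<close>, the generating series \<open>\<Sum>\<^sub>n c\<^sub>n t\<^sup>n\<close> with
  \<open>M\<^sub>N = \<Sum>\<^sub>n\<^sub><\<^sub>N c\<^sub>n\<close> is an iterated integral whose \<open>j\<close>-th one-form depends only on the ratio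
  \<open>\<epsilon>\<^sub>j / \<epsilon>\<^sub>j\<^sub>-\<^sub>1\<close> of consecutive signs. In terms of these ratios the two sums on the left-hand
  side together are the shuffle product of the words \<open>\<delta>\<^sub>1 \<tau>\<^sup>a\<^sup>-\<^sup>m\<close> and \<open>\<delta>\<^sub>2 \<tau>\<^sup>m\<close>, so they are obtained
  from the product of two series by summing its coefficients below \<open>t\<^sup>p\<close>. This is a sum over pairs
  of chains of indices whose largest elements \<open>i\<close>, \<open>j\<close> satisfy \<open>i + j < p\<close>, and replacing each
  \<open>n\<close> of the second chain by \<open>p - n\<close> merges them into the single chain of the right-hand side.
\<close>

section \<open>Arithmetic in \<open>calA\<close> on representatives\<close>

lemma calA_of_add: "calA_of f + calA_of g = calA_of (\<lambda>p. f p + g p)"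
  by (simp add: plus_calA.abs_eq)

lemma calA_of_mult: "calA_of f * calA_of g = calA_of (\<lambda>p. f p * g p)"
  by (simp add: times_calA.abs_eq)

lemma calA_of_sum: "(\<Sum>i\<in>A. calA_of (f i)) = calA_of (\<lambda>p. \<Sum>i\<in>A. f i p)"
proof (cases "finite A")
  case True
  thus ?thesis
    by (induction A rule: finite_induct) (simp_all add: calA_of_add zero_calA.abs_eq)
qed (simp add: zero_calA.abs_eq)

lemma calA_of_const_nat: "of_nat k = calA_of (\<lambda>_. int k)"
  by (induction k) (simp_all add: calA_of_add zero_calA.abs_eq one_calA.abs_eq)

lemma calA_of_const_neg_one_power: "(-1) ^ k = calA_of (\<lambda>_. (-1) ^ k)"
  by (induction k)
    (simp_all add: calA_of_mult one_calA.abs_eq uminus_calA.abs_eq)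

section \<open>Rationals integral at a prime\<close>

text \<open>This is membership in the localization of the integers at \<open>p\<close>. Congruence
  modulo \<open>p\<close> of such rationals is expressed below by p-integrality of their difference
  divided by \<open>p\<close>.\<close>

definition p_integral :: "nat \<Rightarrow> rat \<Rightarrow> bool" where
  "p_integral p x \<longleftrightarrow> (\<exists>c d. coprime d (int p) \<and> x = of_int c / of_int d)"

lemma p_integral_of_int [intro, simp]: "p_integral p (of_int c)"
  unfolding p_integral_def by (rule exI[of _ c], rule exI[of _ 1]) simp

lemma p_integral_0 [simp]: "p_integral p 0"
  using p_integral_of_int[of p 0] by simp

lemma p_integral_1 [simp]: "p_integral p 1"
  using p_integral_of_int[of p 1] by simp

context
  fixes p :: nat
  assumes p: "prime p"
begin

lemma p_integral_mult:
  assumes "p_integral p x" "p_integral p y"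
  shows "p_integral p (x * y)"
proof -
  obtain c d c' d' where "coprime d (int p)" "x = of_int c / of_int d"
      "coprime d' (int p)" "y = of_int c' / of_int d'"
    using assms unfolding p_integral_def by blast
  thus ?thesis unfolding p_integral_def
    by (intro exI[of _ "c * c'"] exI[of _ "d * d'"]) simp
qed

lemma p_integral_add:
  assumes "p_integral p x" "p_integral p y"
  shows "p_integral p (x + y)"
proof -
  obtain c d c' d' where *: "coprime d (int p)" "x = of_int c / of_int d"
      "coprime d' (int p)" "y = of_int c' / of_int d'"
    using assms unfolding p_integral_def by blast
  have "d \<noteq> 0" "d' \<noteq> 0"
    using * p by (auto simp: prime_nat_iff)
  with * show ?thesis unfolding p_integral_def
    by (intro exI[of _ "c * d' + c' * d"] exI[of _ "d * d'"]) (simp add: field_simps)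
qed

lemma p_integral_uminus: "p_integral p x \<Longrightarrow> p_integral p (- x)"
  using p_integral_mult[of "of_int (-1)" x] p_integral_of_int[of p "-1"] by simp

lemma p_integral_diff: "p_integral p x \<Longrightarrow> p_integral p y \<Longrightarrow> p_integral p (x - y)"
  using p_integral_add[of x "- y"] p_integral_uminus[of y] by simp

lemma p_integral_sum: "(\<And>i. i \<in> A \<Longrightarrow> p_integral p (f i)) \<Longrightarrow> p_integral p (\<Sum>i\<in>A. f i)"
  by (induction A rule: infinite_finite_induct) (auto intro: p_integral_add)

lemma p_integral_inverse_nat:
  assumes "0 < n" "n < p"
  shows "p_integral p (1 / of_nat n)"
proof -
  have "coprime (int n) (int p)"
    using p assms by (metis coprime_commute coprime_int_iff nat_dvd_not_less prime_imp_coprime)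
  thus ?thesis unfolding p_integral_def
    by (intro exI[of _ 1] exI[of _ "int n"]) simp
qed

text \<open>A denominator coprime to \<open>p\<close> can be cancelled from a divisibility by
  \<open>p\<close>. The equivalence carries results on rationals back to the congruences in
  \<open>calA_rel\<close>.\<close>

lemma cong_iff_p_integral: "[a = b] (mod int p) \<longleftrightarrow> p_integral p (of_int (a - b) / of_nat p)"
proof
  assume "[a = b] (mod int p)"
  then obtain k where "a - b = int p * k"
    unfolding cong_iff_dvd_diff by (elim dvdE)
  hence "(of_int (a - b) :: rat) = of_nat p * of_int k"
    by (metis of_int_mult of_int_of_nat_eq)
  hence "of_int (a - b) / of_nat p = (of_int k :: rat)"
    using p by (simp add: prime_gt_0_nat)
  thus "p_integral p (of_int (a - b) / of_nat p)"
    by simp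
next
  assume "p_integral p (of_int (a - b) / of_nat p)"
  then obtain c d where *: "coprime d (int p)"
      "of_int (a - b) / of_nat p = (of_int c / of_int d :: rat)"
    unfolding p_integral_def by blast
  have "d \<noteq> 0" using * p by (auto simp: prime_nat_iff)
  with *(2) p have "of_int (a - b) * of_int d = (of_nat p * of_int c :: rat)"
    using prime_gt_0_nat[OF p] by (simp add: field_simps)
  hence "of_int ((a - b) * d) = (of_int (int p * c) :: rat)"
    by simp
  hence "(a - b) * d = int p * c"
    by (simp only: of_int_eq_iff)
  hence "int p dvd (a - b) * d"
    by simp
  thus "[a = b] (mod int p)"
    using *(1) by (simp add: cong_iff_dvd_diff coprime_commute coprime_dvd_mult_left_iff)
qed

text \<open>The lowest-terms denominator given by \<open>quotient_of\<close> divides every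
  denominator of \<open>x\<close>, in particular one coprime to \<open>p\<close>, so its modular
  inverse is a true inverse.\<close>

lemma rat_mod_cong:
  assumes "p_integral p x"
  shows "p_integral p ((of_int (rat_mod p x) - x) / of_nat p)"
proof -
  obtain c d where cd: "quotient_of x = (c, d)" by (cases "quotient_of x")
  have x: "x = of_int c / of_int d" and d: "d > 0" and co: "coprime c d"
    using cd by (auto dest: quotient_of_div quotient_of_denom_pos quotient_of_coprime)
  obtain c' d' where *: "coprime d' (int p)" "x = of_int c' / of_int d'"
    using assms unfolding p_integral_def by blast
  have "d' \<noteq> 0" using * p by (auto simp: prime_nat_iff)
  moreover have "of_int c / of_int d = (of_int c' / of_int d' :: rat)"
    by (rule trans[OF x[symmetric] *(2)])
  ultimately have "of_int c * of_int d' = (of_int c' * of_int d :: rat)"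
    using d by (simp add: frac_eq_eq)
  hence "of_int (c * d') = (of_int (c' * d) :: rat)"
    by simp
  hence "c * d' = c' * d"
    by (simp only: of_int_eq_iff)
  hence "d dvd c * d'" by simp
  hence "d dvd d'"
    using co by (simp add: coprime_commute coprime_dvd_mult_right_iff)
  hence dp: "coprime d (int p)"
    by (rule coprime_divisors[OF _ dvd_refl *(1)])
  have "[rat_mod p x * d = c * (d * modular_inverse (int p) d)] (mod int p)"
    unfolding rat_mod_def cd by (simp add: cong_def mod_mult_left_eq mod_mult_right_eq mult_ac)
  also have "[c * (d * modular_inverse (int p) d) = c * 1] (mod int p)"
    by (intro cong_mult cong_refl) (metis dp cong_modular_inverse1)
  finally have "p_integral p (of_int (rat_mod p x * d - c) / of_nat p)"
    by (simp add: cong_iff_p_integral)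
  moreover have "p_integral p (1 / of_int d)"
    unfolding p_integral_def using dp by (intro exI[of _ 1] exI[of _ d]) simp
  ultimately have "p_integral p (of_int (rat_mod p x * d - c) / of_nat p * (1 / of_int d))"
    by (rule p_integral_mult)
  also have "of_int (rat_mod p x * d - c) / of_nat p * (1 / of_int d)
      = (of_int (rat_mod p x) - x) / of_nat p"
  proof -
    have "(r * e - b) / q * (1 / e) = (r - b / e) / q" if "e \<noteq> 0" for r e b q :: rat
      using that by (simp add: diff_divide_distrib)
    from this[of "of_int d" "of_int (rat_mod p x)" "of_int c" "of_nat p"] d
    show ?thesis by (simp add: x[symmetric])
  qed
  finally show ?thesis .
qed

end

section \<open>Mixed sums and their generating series\<close>

abbreviation mmv1 :: "nat \<Rightarrow> int list \<Rightarrow> rat" where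
  "mmv1 N es \<equiv> mmv_sum N (replicate (length es) 1) es"

lemma mmv_sum_Nil [simp]: "mmv_sum N [] [] = 1"
proof -
  have "{ms :: nat list. length ms = length ([] :: nat list) \<and> sorted_wrt (<) ms \<and> set ms \<subseteq> {0<..<N}} = {[]}"
    by auto
  thus ?thesis unfolding mmv_sum_def by simp
qed

text \<open>Splits off the largest index \<open>n\<close>; the other indices then range below
  \<open>n\<close> and form a shorter sum with bound \<open>n\<close>.\<close>

lemma mmv_sum_snoc:
  assumes len: "length es = length ks"
  shows "mmv_sum N (ks @ [k]) (es @ [e]) =
    (\<Sum>n\<in>{0<..<N}. of_int (1 + e * (-1) ^ n) / of_nat n ^ k * mmv_sum n ks es)"
proof -
  let ?A = "\<lambda>n. {ms :: nat list. length ms = length ks \<and> sorted_wrt (<) ms \<and> set ms \<subseteq> {0<..<n}}"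
  let ?B = "{ms :: nat list. length ms = length (ks @ [k]) \<and> sorted_wrt (<) ms \<and> set ms \<subseteq> {0<..<N}}"
  let ?h = "\<lambda>(n, ms). ms @ [n]"
  let ?g = "\<lambda>ms. (\<Prod>j<length ks. of_int (1 + es ! j * (-1) ^ (ms ! j))) /
        (\<Prod>j<length ks. of_nat (ms ! j) ^ (ks ! j)) :: rat"
  let ?G = "\<lambda>ms. (\<Prod>j<length (ks @ [k]). of_int (1 + (es @ [e]) ! j * (-1) ^ (ms ! j))) /
        (\<Prod>j<length (ks @ [k]). of_nat (ms ! j) ^ ((ks @ [k]) ! j)) :: rat"
  have fin: "finite (?A n)" for n
    by (rule finite_subset[OF _ finite_lists_length_eq[of "{0<..<n}" "length ks"]]) auto
  have bij: "bij_betw ?h (SIGMA n:{0<..<N}. ?A n) ?B"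
  proof (rule bij_betw_imageI)
    show "inj_on ?h (SIGMA n:{0<..<N}. ?A n)"
      by (auto simp: inj_on_def)
    show "?h ` (SIGMA n:{0<..<N}. ?A n) = ?B"
    proof (intro equalityI subsetI)
      fix xs assume xs: "xs \<in> ?B"
      hence "xs \<noteq> []" by auto
      then obtain ms n where "xs = ms @ [n]"
        by (metis append_butlast_last_id)
      with xs have "(n, ms) \<in> (SIGMA n:{0<..<N}. ?A n)"
        by (auto simp: sorted_wrt_append)
      thus "xs \<in> ?h ` (SIGMA n:{0<..<N}. ?A n)"
        using \<open>xs = ms @ [n]\<close> by (auto intro!: image_eqI[of _ _ "(n, ms)"])
    qed (auto simp: sorted_wrt_append subset_iff)
  qed
  have G: "?G (ms @ [n]) = of_int (1 + e * (-1) ^ n) / of_nat n ^ k * ?g ms"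
    if "ms \<in> ?A n" for ms n
  proof -
    have l: "length ms = length ks" using that by simp
    have *: "(\<Prod>j<length ks. of_int (1 + (es @ [e]) ! j * (-1) ^ ((ms @ [n]) ! j)) :: rat)
        = (\<Prod>j<length ks. of_int (1 + es ! j * (-1) ^ (ms ! j)))"
      by (rule prod.cong) (use l len in \<open>auto simp: nth_append\<close>)
    have **: "(\<Prod>j<length ks. of_nat ((ms @ [n]) ! j) ^ ((ks @ [k]) ! j) :: rat)
        = (\<Prod>j<length ks. of_nat (ms ! j) ^ (ks ! j))"
      by (rule prod.cong) (use l len in \<open>auto simp: nth_append\<close>)
    have e1: "(es @ [e]) ! length ks = e" "(ms @ [n]) ! length ks = n"
      "(ks @ [k]) ! length ks = k"
      using l len by (simp_all add: nth_append)
    show ?thesis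
      by (simp only: length_append list.size add_0_right add_Suc_right prod.lessThan_Suc * ** e1)
        (simp add: mult_ac)
  qed
  have "mmv_sum N (ks @ [k]) (es @ [e]) = sum ?G ?B"
    by (simp only: mmv_sum_def)
  also have "\<dots> = (\<Sum>x\<in>(SIGMA n:{0<..<N}. ?A n). ?G (?h x))"
    by (rule sum.reindex_bij_betw[OF bij, symmetric])
  also have "\<dots> = (\<Sum>(n, ms)\<in>(SIGMA n:{0<..<N}. ?A n). ?G (ms @ [n]))"
    by (simp only: case_prod_unfold)
  also have "\<dots> = (\<Sum>n\<in>{0<..<N}. \<Sum>ms\<in>?A n. ?G (ms @ [n]))"
    by (rule sum.Sigma[symmetric]) (use fin in auto)
  also have "\<dots> = (\<Sum>n\<in>{0<..<N}. \<Sum>ms\<in>?A n. of_int (1 + e * (-1) ^ n) / of_nat n ^ k * ?g ms)"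
    by (intro sum.cong refl G)
  also have "\<dots> = (\<Sum>n\<in>{0<..<N}. of_int (1 + e * (-1) ^ n) / of_nat n ^ k * mmv_sum n ks es)"
    by (simp only: mmv_sum_def sum_distrib_left)
  finally show ?thesis .
qed

unbundle fps_syntax

text \<open>The coefficient at \<open>n\<close> is the part of the sum with largest index
  \<open>n\<close>. The empty word gets the series 1, as if its largest index were 0.\<close>

definition mmv_fps :: "int list \<Rightarrow> rat fps" where
  "mmv_fps es = (if es = [] then 1
     else Abs_fps (\<lambda>n. of_int (1 + last es * (-1) ^ n) / of_nat n * mmv1 n (butlast es)))"

lemma mmv_fps_Nil [simp]: "mmv_fps [] = 1"
  by (simp add: mmv_fps_def)

lemma mmv_fps_snoc_nth:
  "mmv_fps (es @ [e]) $ n = of_int (1 + e * (-1) ^ n) / of_nat n * mmv1 n es"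
  by (simp add: mmv_fps_def)

lemma mmv_fps_nth_0: "es \<noteq> [] \<Longrightarrow> mmv_fps es $ 0 = 0"
  by (simp add: mmv_fps_def)

lemma mmv1_eq_sum:
  assumes "N > 0"
  shows "mmv1 N es = (\<Sum>n<N. mmv_fps es $ n)"
proof (cases es rule: rev_exhaust)
  case Nil
  thus ?thesis using assms by (simp add: if_distrib cong: if_cong)
next
  case (snoc fs e)
  have "mmv1 N es = (\<Sum>n\<in>{0<..<N}. mmv_fps es $ n)"
    using mmv_sum_snoc[of fs "replicate (length fs) 1" N 1 e]
    by (simp add: snoc mmv_fps_snoc_nth replicate_append_same)
  \<comment> \<open>The added index 0 contributes nothing, since division by \<open>of_nat 0\<close>
    yields 0.\<close>
  also have "\<dots> = (\<Sum>n<N. mmv_fps es $ n)"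
    by (rule sum.mono_neutral_left) (auto simp: snoc mmv_fps_snoc_nth)
  finally show ?thesis .
qed

text \<open>Both sides run over the pairs with \<open>i + j < N\<close>, grouped by
  \<open>i + j\<close> on the left and by \<open>j\<close> on the right.\<close>

lemma sum_fps_mult_nth:
  fixes f g :: "'a :: comm_semiring_1 fps"
  shows "(\<Sum>n<N. (f * g) $ n) = (\<Sum>j<N. g $ j * (\<Sum>i<N - j. f $ i))"
proof -
  have "(\<Sum>n<N. (f * g) $ n) = (\<Sum>n<N. \<Sum>j\<le>n. g $ j * f $ (n - j))"
    by (intro sum.cong refl) (simp add: fps_mult_nth mult.commute[of f g] atMost_atLeast0)
  also have "\<dots> = (\<Sum>n<N. \<Sum>j | j < N \<and> j \<le> n. g $ j * f $ (n - j))"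
    by (intro sum.cong refl) auto
  also have "\<dots> = (\<Sum>n\<in>{..<N}. \<Sum>j\<in>{j\<in>{..<N}. j \<le> n}. g $ j * f $ (n - j))"
    by simp
  also have "\<dots> = (\<Sum>j\<in>{..<N}. \<Sum>n\<in>{n\<in>{..<N}. j \<le> n}. g $ j * f $ (n - j))"
    by (rule sum.swap_restrict) auto
  also have "\<dots> = (\<Sum>j<N. g $ j * (\<Sum>i<N - j. f $ i))"
  proof (intro sum.cong refl)
    fix j assume "j \<in> {..<N}"
    show "(\<Sum>n\<in>{n\<in>{..<N}. j \<le> n}. g $ j * f $ (n - j)) = g $ j * (\<Sum>i<N - j. f $ i)"
      unfolding sum_distrib_left
      by (rule sum.reindex_bij_witness[of _ "\<lambda>i. i + j" "\<lambda>n. n - j"]) auto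
  qed
  finally show ?thesis .
qed

section \<open>Reversal of indices modulo \<open>p\<close>\<close>

context
  fixes p :: nat
  assumes p: "prime p"
begin

text \<open>The bound \<open>N \<le> p\<close> keeps all indices, and hence all factors of the
  denominators, strictly between 0 and \<open>p\<close>.\<close>

lemma p_integral_mmv1:
  "N \<le> p \<Longrightarrow> p_integral p (mmv1 N es)"
proof (induction es arbitrary: N rule: rev_induct)
  case (snoc e es)
  have "mmv1 N (es @ [e]) =
      (\<Sum>n\<in>{0<..<N}. of_int (1 + e * (-1) ^ n) * (1 / of_nat n) * mmv1 n es)"
    using mmv_sum_snoc[of es "replicate (length es) 1" N 1 e]
    by (simp add: replicate_append_same)
  also have "p_integral p \<dots>"
    using snoc by (intro p_integral_sum p_integral_mult p_integral_inverse_nat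
      p_integral_of_int p snoc.IH) auto
  finally show ?case .
qed simp

lemma p_integral_mmv_fps:
  assumes "n < p"
  shows "p_integral p (mmv_fps es $ n)"
proof (cases es rule: rev_exhaust)
  case (snoc fs e)
  show ?thesis
  proof (cases "n = 0")
    case False
    hence "p_integral p (of_int (1 + e * (-1) ^ n) * (1 / of_nat n) * mmv1 n fs)"
      using assms by (intro p_integral_mult p_integral_inverse_nat p p_integral_mmv1 p_integral_of_int) auto
    thus ?thesis by (simp add: snoc mmv_fps_snoc_nth)
  qed (simp add: snoc mmv_fps_snoc_nth)
qed simp

text \<open>
  Replacing the last index \<open>n\<close> of \<open>v\<close> by \<open>p - n\<close> flips its parity, as \<open>p\<close> is odd, and
  \<open>1 / (p - n) \<equiv> - 1 / n\<close>; this accounts for the sign changes.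
\<close>

lemma mmv1_append_rev:
  assumes "odd p"
  shows "p_integral p ((mmv1 p (u @ map uminus (rev v))
           - (-1) ^ length v * (\<Sum>n<p. (mmv_fps u * mmv_fps v) $ n)) / of_nat p)"
proof (induction v arbitrary: u rule: rev_induct)
  case Nil
  show ?case using mmv1_eq_sum[of p u] prime_gt_0_nat[OF p] by simp
next
  case (snoc e v)
  have pos: "p > 0" using p by (simp add: prime_gt_0_nat)
  \<comment> \<open>The induction hypothesis at \<open>u @ [-e]\<close> compares \<open>L\<close>
    with \<open>X\<close>. The goal compares \<open>L\<close> with \<open>Y\<close> under the
    opposite sign, so it remains to show that \<open>p\<close> divides \<open>X + Y\<close>.\<close>
  define L where "L = mmv1 p (u @ map uminus (rev (v @ [e])))"
  define X where "X = (\<Sum>n<p. (mmv_fps (u @ [-e]) * mmv_fps v) $ n)"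
  define Y where "Y = (\<Sum>n<p. (mmv_fps u * mmv_fps (v @ [e])) $ n)"
  have IH: "p_integral p ((L - (-1) ^ length v * X) / of_nat p)"
    using snoc.IH[of "u @ [-e]"] by (simp add: L_def X_def)
  let ?c = "\<lambda>n. of_int (1 + e * (-1) ^ n) :: rat"
  have "X = (\<Sum>n<p. mmv_fps (u @ [-e]) $ n * (\<Sum>i<p - n. mmv_fps v $ i))"
    unfolding X_def by (subst mult.commute) (rule sum_fps_mult_nth)
  also have "\<dots> = (\<Sum>n\<in>{0<..<p}. mmv_fps (u @ [-e]) $ n * (\<Sum>i<p - n. mmv_fps v $ i))"
    by (rule sum.mono_neutral_right) (auto simp: mmv_fps_snoc_nth)
  also have "\<dots> = (\<Sum>j\<in>{0<..<p}. ?c j / of_nat (p - j) * mmv1 (p - j) u * mmv1 j v)"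
  proof (rule sum.reindex_bij_witness[of _ "\<lambda>j. p - j" "\<lambda>j. p - j"])
    fix n assume n: "n \<in> {0<..<p}"
    have "(-1) ^ (p - n) = - ((-1) ^ n :: int)"
      using n \<open>odd p\<close> by (cases "even n") auto
    thus "?c (p - n) / of_nat (p - (p - n)) * mmv1 (p - (p - n)) u * mmv1 (p - n) v
        = mmv_fps (u @ [-e]) $ n * (\<Sum>i<p - n. mmv_fps v $ i)"
      using n mmv1_eq_sum[of "p - n" v] by (simp add: mmv_fps_snoc_nth)
  qed auto
  finally have X: "X = \<dots>" .
  have "Y = (\<Sum>j<p. mmv_fps (v @ [e]) $ j * (\<Sum>i<p - j. mmv_fps u $ i))"
    unfolding Y_def by (rule sum_fps_mult_nth)
  also have "\<dots> = (\<Sum>j\<in>{0<..<p}. mmv_fps (v @ [e]) $ j * (\<Sum>i<p - j. mmv_fps u $ i))"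
    by (rule sum.mono_neutral_right) (auto simp: mmv_fps_snoc_nth)
  also have "\<dots> = (\<Sum>j\<in>{0<..<p}. ?c j / of_nat j * mmv1 j v * mmv1 (p - j) u)"
    by (intro sum.cong refl) (simp add: mmv_fps_snoc_nth mmv1_eq_sum del: One_nat_def)
  finally have Y: "Y = \<dots>" .
  \<comment> \<open>Termwise, \<open>1 / (p - j) + 1 / j = p / (j * (p - j))\<close>; the factor
    \<open>p\<close> cancels and the remaining denominators are prime to \<open>p\<close>.\<close>
  have "(X + Y) / of_nat p =
      (\<Sum>j\<in>{0<..<p}. ?c j * (1 / of_nat j) * (1 / of_nat (p - j)) * mmv1 j v * mmv1 (p - j) u)"
    unfolding X Y sum.distrib[symmetric] sum_divide_distrib
  proof (intro sum.cong refl)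
    fix j assume j: "j \<in> {0<..<p}"
    have *: "(c / x * U * V + c / y * V * U) / (x + y) = c * (1 / y) * (1 / x) * V * U"
      if "x \<noteq> 0" "y \<noteq> 0" "x + y \<noteq> 0" for c x y U V :: rat
      using that by (simp add: divide_simps) (simp add: algebra_simps)
    have "of_nat (p - j) + of_nat j = (of_nat p :: rat)"
      using j by (simp add: of_nat_diff)
    thus "(?c j / of_nat (p - j) * mmv1 (p - j) u * mmv1 j v
          + ?c j / of_nat j * mmv1 j v * mmv1 (p - j) u) / of_nat p
        = ?c j * (1 / of_nat j) * (1 / of_nat (p - j)) * mmv1 j v * mmv1 (p - j) u"
      using *[of "of_nat (p - j)" "of_nat j"] j pos by simp
  qed
  also have "p_integral p \<dots>"
    by (intro p_integral_sum p_integral_mult p_integral_inverse_nat p p_integral_mmv1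
        p_integral_of_int) auto
  finally have XY: "p_integral p ((X + Y) / of_nat p)" .
  have "p_integral p ((L - (-1) ^ length v * X) / of_nat p
      + of_int ((-1) ^ length v) * ((X + Y) / of_nat p))"
    by (intro p_integral_add p_integral_mult p IH XY p_integral_of_int)
  also have "(L - (-1) ^ length v * X) / of_nat p
      + of_int ((-1) ^ length v) * ((X + Y) / of_nat p)
      = (L - (-1) ^ length (v @ [e]) * Y) / of_nat p"
    using pos by (simp add: field_simps)
  finally show ?case
    by (simp only: L_def Y_def)
qed

end

section \<open>Derivatives of the generating series\<close>

text \<open>
  The series of the one-form in the iterated integral representation: \<open>2 t / (1 - t\<^sup>2)\<close> for
  \<open>\<eta> = 1\<close>, where consecutive indices have equal parity, and \<open>2 / (1 - t\<^sup>2)\<close> for \<open>\<eta> = -1\<close>.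
\<close>

definition form_fps :: "int \<Rightarrow> rat fps" where
  "form_fps \<eta> = Abs_fps (\<lambda>n. of_int (1 - \<eta> * (-1) ^ n))"

text \<open>The derivative cancels the factor \<open>1 / n\<close> of the last index. As the
  previous index \<open>i\<close> has parity fixed by \<open>f\<close>, the remaining sign factor
  depends only on the difference of the two indices, so the sum over \<open>i\<close> is a Cauchy
  product.\<close>

lemma fps_deriv_mmv_fps_snoc:
  assumes "\<And>n. mmv_fps es $ n \<noteq> 0 \<Longrightarrow> (-1) ^ n = f"
  shows "fps_deriv (mmv_fps (es @ [f * \<eta>])) = form_fps \<eta> * mmv_fps es"
proof (rule fps_ext)
  fix n
  have "fps_deriv (mmv_fps (es @ [f * \<eta>])) $ n =
      of_int (1 + f * \<eta> * (-1) ^ Suc n) * mmv1 (Suc n) es"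
    by (simp add: mmv_fps_snoc_nth del: of_nat_Suc)
  also have "\<dots> = (\<Sum>i\<le>n. of_int (1 + f * \<eta> * (-1) ^ Suc n) * mmv_fps es $ i)"
    by (subst mmv1_eq_sum) (simp_all add: sum_distrib_left lessThan_Suc_atMost)
  also have "\<dots> = (\<Sum>i\<le>n. of_int (1 - \<eta> * (-1) ^ (n - i)) * mmv_fps es $ i)"
  proof (intro sum.cong refl)
    fix i assume i: "i \<in> {..n}"
    show "of_int (1 + f * \<eta> * (-1) ^ Suc n) * mmv_fps es $ i =
        of_int (1 - \<eta> * (-1) ^ (n - i)) * mmv_fps es $ i"
    proof (cases "mmv_fps es $ i = 0")
      case False
      hence f: "f = (-1) ^ i" using assms by simp
      have "f * (-1) ^ n = (-1) ^ (n - i)"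
        using i unfolding f by (cases "even i"; cases "even n") auto
      hence "f * \<eta> * (-1) ^ Suc n = - (\<eta> * (-1) ^ (n - i))"
        by (simp add: mult_ac)
      hence "1 + f * \<eta> * (-1) ^ Suc n = 1 - \<eta> * (-1) ^ (n - i)"
        by (simp only: add_uminus_conv_diff)
      thus ?thesis by (simp only:)
    qed simp
  qed
  also have "\<dots> = (mmv_fps es * form_fps \<eta>) $ n"
    by (simp add: fps_mult_nth form_fps_def atMost_atLeast0 mult.commute)
  finally show "fps_deriv (mmv_fps (es @ [f * \<eta>])) $ n = (form_fps \<eta> * mmv_fps es) $ n"
    by (simp add: mult.commute)
qed

lemma fps_deriv_mmv_fps_single: "fps_deriv (mmv_fps [\<eta>]) = form_fps \<eta>"
  using fps_deriv_mmv_fps_snoc[of "[]" 1 \<eta>] by (simp split: if_splits)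

text \<open>A last sign \<open>f\<close> makes the factor \<open>1 + f * (-1) ^ n\<close> vanish
  unless \<open>(-1) ^ n = f\<close>, which is the required support condition.\<close>

lemma fps_deriv_mmv_fps:
  assumes "f \<in> {1, -1}"
  shows "fps_deriv (mmv_fps (es @ [f, f * \<eta>])) = form_fps \<eta> * mmv_fps (es @ [f])"
proof -
  have "(-1) ^ n = f" if "mmv_fps (es @ [f]) $ n \<noteq> 0" for n
    using that assms by (cases "even n") (auto simp: mmv_fps_snoc_nth)
  from fps_deriv_mmv_fps_snoc[of "es @ [f]" f \<eta>, OF this] show ?thesis by simp
qed

lemma fps_deriv_cancel:
  fixes f g :: "'a :: {idom, semiring_char_0} fps"
  assumes "fps_deriv f = fps_deriv g" "f $ 0 = g $ 0"
  shows "f = g"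
  using assms by (simp add: fps_deriv_eq_iff)

section \<open>Shuffle product of sign words\<close>

text \<open>Read through ratios of consecutive signs, this is the word
  \<open>\<delta> \<tau>^k\<close>.\<close>

definition geom_signs :: "int \<Rightarrow> int \<Rightarrow> nat \<Rightarrow> int list" where
  "geom_signs \<tau> \<delta> k = map (\<lambda>s. \<delta> * \<tau> ^ s) [0..<k + 1]"

text \<open>In ratios this is the word
  \<open>\<delta> \<tau>^(a-i) \<delta>' \<tau>^i\<close>.\<close>

definition step_signs :: "int \<Rightarrow> int \<Rightarrow> int \<Rightarrow> nat \<Rightarrow> nat \<Rightarrow> int list" where
  "step_signs \<tau> \<delta> \<delta>' a i =
     geom_signs \<tau> \<delta> (a - i) @ map (\<lambda>s. \<delta> * \<delta>' * \<tau> ^ s) [a - i..<a + 1]"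

lemma length_step_signs: "i \<le> a \<Longrightarrow> length (step_signs \<tau> \<delta> \<delta>' a i) = a + 2"
  by (simp add: step_signs_def geom_signs_def)

text \<open>These are the shuffles of \<open>\<delta> \<tau>^(a-m)\<close> and
  \<open>\<delta>' \<tau>^m\<close> that begin with \<open>\<delta>\<close>: the binomial counts
  which \<open>m\<close> of the \<open>i\<close> letters \<tau> after \<open>\<delta>'\<close> come
  from the second word.\<close>

definition step_sum :: "int \<Rightarrow> int \<Rightarrow> int \<Rightarrow> nat \<Rightarrow> nat \<Rightarrow> rat fps" where
  "step_sum \<tau> \<delta> \<delta>' a m = (\<Sum>i\<le>a. of_nat (i choose m) * mmv_fps (step_signs \<tau> \<delta> \<delta>' a i))"

lemma step_sum_nth_0: "step_sum \<tau> \<delta> \<delta>' a m $ 0 = 0"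
  by (simp add: step_sum_def fps_sum_nth mmv_fps_nth_0 step_signs_def)

lemma step_sum_gt: "m > a \<Longrightarrow> step_sum \<tau> \<delta> \<delta>' a m = 0"
  unfolding step_sum_def by (intro sum.neutral) (auto simp: binomial_eq_0)

lemma deriv_geom_0: "fps_deriv (mmv_fps (geom_signs \<tau> \<delta> 0)) = form_fps \<delta>"
  by (simp add: geom_signs_def fps_deriv_mmv_fps_single)

lemma sign_mult_power: "\<delta> * \<tau> ^ s \<in> {1, -1 :: int}" if "\<delta> \<in> {1, -1}" "\<tau> \<in> {1, -1}"
  using that by (cases "even s") auto

context
  fixes \<tau> :: int
  assumes \<tau>: "\<tau> \<in> {1, -1}"
begin

lemma deriv_geom_Suc:
  assumes "\<delta> \<in> {1, -1}"
  shows "fps_deriv (mmv_fps (geom_signs \<tau> \<delta> (Suc k))) = form_fps \<tau> * mmv_fps (geom_signs \<tau> \<delta> k)"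
  using fps_deriv_mmv_fps[OF sign_mult_power[OF assms \<tau>, of k], of "map (\<lambda>s. \<delta> * \<tau> ^ s) [0..<k]" \<tau>]
  by (simp add: geom_signs_def mult_ac)

lemma deriv_step_0:
  assumes "\<delta> \<in> {1, -1}"
  shows "fps_deriv (mmv_fps (step_signs \<tau> \<delta> \<delta>' a 0)) = form_fps \<delta>' * mmv_fps (geom_signs \<tau> \<delta> a)"
  using fps_deriv_mmv_fps[OF sign_mult_power[OF assms \<tau>, of a], of "map (\<lambda>s. \<delta> * \<tau> ^ s) [0..<a]" \<delta>']
  by (simp add: geom_signs_def step_signs_def mult_ac)

lemma deriv_step_Suc:
  assumes "\<delta> \<in> {1, -1}" "\<delta>' \<in> {1, -1}" "i \<le> a"
  shows "fps_deriv (mmv_fps (step_signs \<tau> \<delta> \<delta>' (Suc a) (Suc i))) =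
    form_fps \<tau> * mmv_fps (step_signs \<tau> \<delta> \<delta>' a i)"
proof -
  have "\<delta> * \<delta>' \<in> {1, -1}" using assms by auto
  from fps_deriv_mmv_fps[OF sign_mult_power[OF this \<tau>, of a],
      of "geom_signs \<tau> \<delta> (a - i) @ map (\<lambda>s. \<delta> * \<delta>' * \<tau> ^ s) [a - i..<a]" \<tau>]
  moreover have "a - i \<le> Suc a"
    using assms(3) by arith
  ultimately show ?thesis using assms(3)
    by (simp add: step_signs_def mult_ac)
qed

context
  fixes \<delta> \<delta>' :: int
  assumes \<delta>: "\<delta> \<in> {1, -1}" "\<delta>' \<in> {1, -1}"
begin

text \<open>Differentiation removes the last letter, which is \<open>\<delta>'\<close> for
  \<open>i = 0\<close> and \<tau> otherwise; all binomials are 1 here.\<close>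

lemma deriv_step_sum_0:
  "fps_deriv (step_sum \<tau> \<delta> \<delta>' 0 0) = form_fps \<delta>' * mmv_fps (geom_signs \<tau> \<delta> 0)"
  "fps_deriv (step_sum \<tau> \<delta> \<delta>' (Suc a) 0) =
     form_fps \<delta>' * mmv_fps (geom_signs \<tau> \<delta> (Suc a)) + form_fps \<tau> * step_sum \<tau> \<delta> \<delta>' a 0"
proof -
  show "fps_deriv (step_sum \<tau> \<delta> \<delta>' 0 0) = form_fps \<delta>' * mmv_fps (geom_signs \<tau> \<delta> 0)"
    by (simp add: step_sum_def deriv_step_0[OF \<delta>(1)])
  have "fps_deriv (step_sum \<tau> \<delta> \<delta>' (Suc a) 0) =
      fps_deriv (mmv_fps (step_signs \<tau> \<delta> \<delta>' (Suc a) 0)) +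
      (\<Sum>i\<le>a. fps_deriv (mmv_fps (step_signs \<tau> \<delta> \<delta>' (Suc a) (Suc i))))"
    by (simp add: step_sum_def sum.atMost_Suc_shift fps_deriv_sum del: sum.atMost_Suc)
  also have "\<dots> = form_fps \<delta>' * mmv_fps (geom_signs \<tau> \<delta> (Suc a)) + form_fps \<tau> * step_sum \<tau> \<delta> \<delta>' a 0"
    by (simp add: step_sum_def deriv_step_0[OF \<delta>(1)] deriv_step_Suc[OF \<delta>] sum_distrib_left)
  finally show "fps_deriv (step_sum \<tau> \<delta> \<delta>' (Suc a) 0) = \<dots>" .
qed

text \<open>The word with \<open>i = 0\<close> has coefficient 0, so every remaining word ends in
  \<tau>. Pascal's rule records which of the two words that \<tau> came from.\<close>

lemma deriv_step_sum_Suc: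
  "fps_deriv (step_sum \<tau> \<delta> \<delta>' (Suc a) (Suc m)) =
     form_fps \<tau> * (step_sum \<tau> \<delta> \<delta>' a m + step_sum \<tau> \<delta> \<delta>' a (Suc m))"
proof -
  have "fps_deriv (step_sum \<tau> \<delta> \<delta>' (Suc a) (Suc m)) =
      (\<Sum>i\<le>a. of_nat (Suc i choose Suc m) * fps_deriv (mmv_fps (step_signs \<tau> \<delta> \<delta>' (Suc a) (Suc i))))"
    by (simp add: step_sum_def sum.atMost_Suc_shift fps_deriv_sum
        del: sum.atMost_Suc binomial_Suc_Suc)
  also have "\<dots> = (\<Sum>i\<le>a. form_fps \<tau> * (of_nat (i choose m) * mmv_fps (step_signs \<tau> \<delta> \<delta>' a i)
      + of_nat (i choose Suc m) * mmv_fps (step_signs \<tau> \<delta> \<delta>' a i)))"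
    by (intro sum.cong refl) (simp add: deriv_step_Suc[OF \<delta>] algebra_simps)
  also have "\<dots> = form_fps \<tau> * (step_sum \<tau> \<delta> \<delta>' a m + step_sum \<tau> \<delta> \<delta>' a (Suc m))"
    by (simp only: step_sum_def sum_distrib_left[symmetric] sum.distrib)
  finally show ?thesis .
qed

end

text \<open>The product rule removes the last letter of either factor, which is the recursion of the
  shuffle product. By induction both sides have equal derivatives, and both constant terms are
  0.\<close>

lemma geom_shuffle:
  assumes "\<delta>1 \<in> {1, -1}" "\<delta>2 \<in> {1, -1}"
  shows "mmv_fps (geom_signs \<tau> \<delta>1 k) * mmv_fps (geom_signs \<tau> \<delta>2 m) =
    step_sum \<tau> \<delta>1 \<delta>2 (k + m) m + step_sum \<tau> \<delta>2 \<delta>1 (k + m) k" (is "?L k m = ?R k m")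
proof (induction "k + m" arbitrary: k m rule: less_induct)
  case less
  have 0: "?L k m $ 0 = ?R k m $ 0"
    by (simp add: step_sum_nth_0 mmv_fps_nth_0 geom_signs_def)
  show ?case
  proof (rule fps_deriv_cancel[OF _ 0])
    note derivs = deriv_geom_0 deriv_geom_Suc deriv_step_sum_0 deriv_step_sum_Suc
    show "fps_deriv (?L k m) = fps_deriv (?R k m)"
    proof (cases k)
      case k: 0
      show ?thesis
      proof (cases m)
        case 0
        thus ?thesis using k assms by (simp add: derivs mult_ac add_ac)
      next
        case (Suc m')
        have "?L 0 m' = ?R 0 m'" using less[of 0 m'] k Suc by simp
        \<comment> \<open>Pascal's rule leaves one sum with binomials \<open>i choose Suc m'\<close>
          for \<open>i \<le> m'\<close>, all zero: the one-letter word \<open>\<delta>1\<close> has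
          no \<tau> to lose.\<close>
        thus ?thesis using k Suc assms
          by (simp add: derivs step_sum_gt algebra_simps)
      qed
    next
      case k: (Suc k')
      have 1: "?L k' m = ?R k' m" using less[of k' m] k by simp
      show ?thesis
      proof (cases m)
        case 0
        thus ?thesis using k assms 1
          by (simp add: derivs step_sum_gt algebra_simps)
      next
        case (Suc m')
        have "?L k m' = ?R k m'" using less[of k m'] k Suc by simp
        \<comment> \<open>Both factors end in \<tau>, so dropping either last letter leaves a
          product covered by the induction hypothesis.\<close>
        hence "fps_deriv (?L k m) = form_fps \<tau> * (?R k' m + ?R k m')"
          using 1 k Suc assms by (simp add: derivs algebra_simps)
        also have "\<dots> = fps_deriv (?R k m)"
          using k Suc assms by (simp add: derivs algebra_simps)
        finally show ?thesis .
      qed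
    qed
  qed
qed

end

section \<open>The identity modulo odd primes and in \<open>calA\<close>\<close>

lemma sum_step_sum_nth:
  assumes "N > 0"
  shows "(\<Sum>n<N. step_sum \<tau> \<delta> \<delta>' a m $ n) =
    (\<Sum>i\<le>a. of_nat (i choose m) * mmv1 N (step_signs \<tau> \<delta> \<delta>' a i))"
proof -
  have "(\<Sum>n<N. step_sum \<tau> \<delta> \<delta>' a m $ n) =
      (\<Sum>n<N. \<Sum>i\<le>a. of_nat (i choose m) * mmv_fps (step_signs \<tau> \<delta> \<delta>' a i) $ n)"
    by (simp add: step_sum_def fps_sum_nth flip: fps_of_nat)
  also have "\<dots> = (\<Sum>i\<le>a. \<Sum>n<N. of_nat (i choose m) * mmv_fps (step_signs \<tau> \<delta> \<delta>' a i) $ n)"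
    by (rule sum.swap)
  finally show ?thesis
    by (simp only: mmv1_eq_sum[OF assms] sum_distrib_left)
qed

theorem corollary3p4:
  fixes a m :: nat and \<delta>1 \<delta>2 \<tau> :: int
  assumes "\<delta>1 \<in> {1, -1}" and "\<delta>2 \<in> {1, -1}" and "\<tau> \<in> {1, -1}"
    and "m \<le> a"
  shows "(\<Sum>i=0..a. of_nat (i choose m) *
            finite_mmv (replicate (a + 2) 1)
              (map (\<lambda>s. \<delta>1 * \<tau> ^ s) [0..<a - i + 1] @
               map (\<lambda>s. \<delta>1 * \<delta>2 * \<tau> ^ s) [a - i..<a + 1]))
       + (\<Sum>i=0..a. of_nat (i choose (a - m)) *
            finite_mmv (replicate (a + 2) 1)
              (map (\<lambda>s. \<delta>2 * \<tau> ^ s) [0..<a - i + 1] @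
               map (\<lambda>s. \<delta>1 * \<delta>2 * \<tau> ^ s) [a - i..<a + 1]))
       = (-1) ^ (m + 1) *
            finite_mmv (replicate (a + 2) 1)
              (map (\<lambda>s. \<delta>1 * \<tau> ^ s) [0..<a - m + 1] @
               map (\<lambda>s. - (\<delta>2 * \<tau> ^ s)) (rev [0..<m + 1]))"
proof -
  let ?P = "\<lambda>i. step_signs \<tau> \<delta>1 \<delta>2 a i" and ?Q = "\<lambda>i. step_signs \<tau> \<delta>2 \<delta>1 a i"
  let ?u = "geom_signs \<tau> \<delta>1 (a - m)" and ?v = "geom_signs \<tau> \<delta>2 m"
  let ?w = "?u @ map uminus (rev ?v)"
  let ?f = "\<lambda>p es. rat_mod p (mmv_sum p (replicate (a + 2) 1) es)"
  let ?lhs = "\<lambda>p. (\<Sum>i\<le>a. int (i choose m) * ?f p (?P i)) +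
    (\<Sum>i\<le>a. int (i choose (a - m)) * ?f p (?Q i))"
  let ?rhs = "\<lambda>p. (-1) ^ (m + 1) * ?f p ?w"
  have lens: "length (?P i) = a + 2" "length (?Q i) = a + 2" if "i \<le> a" for i
    using that by (simp_all add: length_step_signs)
  have lenw: "length ?w = a + 2"
    using \<open>m \<le> a\<close> by (simp add: geom_signs_def)
  have "[?lhs p = ?rhs p] (mod int p)" if p: "prime p" "odd p" for p
  proof -
    have pos: "p > 0" using p by (simp add: prime_gt_0_nat)
    \<comment> \<open>\<open>?D\<close> is the error of replacing a rational sum by its reduction,
      divided by \<open>p\<close>; it is p-integral.\<close>
    let ?D = "\<lambda>es. (of_int (?f p es) - mmv1 p es) / of_nat p"
    define A B C where "A = (\<Sum>i\<le>a. of_nat (i choose m) * mmv1 p (?P i))"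
      and "B = (\<Sum>i\<le>a. of_nat (i choose (a - m)) * mmv1 p (?Q i))"
      and "C = mmv1 p ?w"
    have D: "p_integral p (?D es)" if "length es = a + 2" for es
      using rat_mod_cong[OF p(1) p_integral_mmv1[OF p(1) order_refl, of es]] that by simp
    have "A + B = (\<Sum>n<p. (mmv_fps ?u * mmv_fps ?v) $ n)"
      using geom_shuffle[OF assms(3,1,2), of "a - m" m] \<open>m \<le> a\<close>
      by (simp add: A_def B_def sum_step_sum_nth pos sum.distrib)
    \<comment> \<open>The exponent \<open>m + 1\<close> is the length of \<open>?v\<close>, the word
      whose indices are reflected.\<close>
    hence "p_integral p ((C - (-1) ^ (m + 1) * (A + B)) / of_nat p)"
      using mmv1_append_rev[OF p, of ?u ?v] by (simp add: C_def geom_signs_def)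
    \<comment> \<open>In this combination \<open>A\<close>, \<open>B\<close> and \<open>C\<close>
      cancel, because the sign squares to 1, and only the difference of the two reduced sides over
      \<open>p\<close> survives.\<close>
    hence "p_integral p ((\<Sum>i\<le>a. of_int (int (i choose m)) * ?D (?P i))
        + (\<Sum>i\<le>a. of_int (int (i choose (a - m))) * ?D (?Q i))
        - of_int ((-1) ^ (m + 1)) * ?D ?w
        - of_int ((-1) ^ (m + 1)) * ((C - (-1) ^ (m + 1) * (A + B)) / of_nat p))"
      by (intro p_integral_add p_integral_diff p_integral_mult p_integral_sum p
          p_integral_of_int D lens lenw) auto
    also have "(\<Sum>i\<le>a. of_int (int (i choose m)) * ?D (?P i)) =
        (of_int (\<Sum>i\<le>a. int (i choose m) * ?f p (?P i)) - A) / of_nat p"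
      by (simp add: A_def sum_divide_distrib sum_subtractf diff_divide_distrib
          right_diff_distrib)
    also have "(\<Sum>i\<le>a. of_int (int (i choose (a - m))) * ?D (?Q i)) =
        (of_int (\<Sum>i\<le>a. int (i choose (a - m)) * ?f p (?Q i)) - B) / of_nat p"
      by (simp add: B_def sum_divide_distrib sum_subtractf diff_divide_distrib
          right_diff_distrib)
    also have "(of_int (\<Sum>i\<le>a. int (i choose m) * ?f p (?P i)) - A) / of_nat p
        + (of_int (\<Sum>i\<le>a. int (i choose (a - m)) * ?f p (?Q i)) - B) / of_nat p
        - of_int ((-1) ^ (m + 1)) * ?D ?w
        - of_int ((-1) ^ (m + 1)) * ((C - (-1) ^ (m + 1) * (A + B)) / of_nat p)
        = of_int (?lhs p - ?rhs p) / of_nat p"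
    proof -
      have *: "(x - A) / q + (y - B) / q - s * ((z - C) / q) - s * ((C - s * (A + B)) / q)
          = (x + y - s * z) / q" if "s * s = 1" for x y z s q :: rat
      proof -
        have "s * (C - s * (A + B)) = s * C - (A + B)"
          by (simp add: right_diff_distrib that flip: mult.assoc)
        thus ?thesis
          by (simp only: times_divide_eq_right)
            (simp add: add_divide_distrib diff_divide_distrib right_diff_distrib)
      qed
      have s: "(-1) ^ (m + 1) * (-1) ^ (m + 1) = (1 :: rat)"
        by (simp flip: power_mult_distrib)
      show ?thesis
        unfolding C_def[symmetric] by (simp only: of_int_diff of_int_add of_int_mult of_int_power of_int_minus of_int_1 *[OF s])
    qed
    finally show ?thesis
      by (simp only: cong_iff_p_integral[OF p(1)])
  qed
  \<comment> \<open>An even prime equals 2, so the congruence can fail at one prime at most, which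
    is invisible in \<open>calA\<close>.\<close>
  hence "{p. prime p \<and> \<not> [?lhs p = ?rhs p] (mod int p)} \<subseteq> {2}"
    using primes_dvd_imp_eq[OF two_is_prime_nat] by blast
  hence "calA_of ?lhs = calA_of ?rhs"
    by (simp add: calA.abs_eq_iff calA_rel_def finite_subset)
  hence "(\<Sum>i\<le>a. of_nat (i choose m) * finite_mmv (replicate (a + 2) 1) (?P i))
      + (\<Sum>i\<le>a. of_nat (i choose (a - m)) * finite_mmv (replicate (a + 2) 1) (?Q i))
      = (-1) ^ (m + 1) * finite_mmv (replicate (a + 2) 1) ?w"
    by (simp only: finite_mmv_def calA_of_const_nat calA_of_const_neg_one_power calA_of_mult
        calA_of_sum calA_of_add)
  thus ?thesis
    by (simp only: step_signs_def geom_signs_def atLeast0AtMost rev_map map_map o_def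
        mult.commute[of \<delta>2 \<delta>1])
qed

end
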